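(* Let $d \geq 1$ and let $V$ be a finite nonempty set. If $(V,\mathcal{H})$ and $(V,\mathcal{H}')$ both belong to $\mathrm{TBPav}(d)$, then $(V,\mathcal{H}\cup\mathcal{H}') \in \mathrm{TBPav}(d)$.
   Context: A (finite) simplicial complex is a pair $S=(V,\mathcal{H})$ where $V$ is a finite nonempty set and $\mathcal{H}\subseteq 2^V$ contains all singletons and is closed under taking subsets. Its rank is $\max\{|I| : I\in\mathcal{H}\}$ and its dimension is rank minus one. $P_n(V)$ (resp. $P_{\leq n}(V)$, $P_{\geq n}(V)$) denotes the set of subsets of $V$ with exactly (resp. at most, at least) $n$ elements. A flat of $S$ is a set $X\subseteq V$ such that $I\cup\{p\}\in\mathcal{H}$ for all $I\in\mathcal{H}\cap 2^X$ and $p\in V\setminus X$. Given a chain $F_0\subset F_1\subset\cdots\subset F_k$ of subsets of $V$, a set $X$ is a transversal of its successive differences if $X$ has an enumeration $x_1,\dots,x_k$ with $x_i\in F_i\setminus F_{i-1}$. $S$ is boolean representable (a BRSC) if there is a boolean matrix $M$ with columns indexed by $V$ such that $\mathcal{H}$ is exactly the set of $X\subseteq V$ for which some square submatrix with column set $X$ is nonsingular, i.e. congruent (by independently permuting rows and columns) to a lower unitriangular boolean matrix; equivalently, $\mathcal{H}$ is the set of transversals of successive differences of chains of flats of $S$. For $k\geq 1$ the $k$-truncation is $T_k(S)=(V,\mathcal{H}\cap P_{\leq k}(V))$. $S$ is a TBRSC (truncated boolean representable simplicial complex) if $S=T_k(S')$ for some BRSC $S'$ and some $k\geq1$. $S$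 is paving if $P_{\dim S}(V)\subseteq\mathcal{H}$. $\mathrm{TBPav}(d)$ denotes the class of paving TBRSCs of dimension $d$. *)

theory Defs
  imports Main
begin

type_synonym 'a cplx = "'a set \<times> 'a set set"

definition simplicial_complex :: "'a cplx \<Rightarrow> bool" where
  "simplicial_complex S \<longleftrightarrow> (case S of (V, H) \<Rightarrow>
     finite V \<and> V \<noteq> {} \<and> H \<subseteq> Pow V \<and> (\<forall>v\<in>V. {v} \<in> H) \<and>
     (\<forall>I\<in>H. \<forall>J. J \<subseteq> I \<longrightarrow> J \<in> H))"

definition cplx_rank :: "'a cplx \<Rightarrow> nat" where
  "cplx_rank S = Max (card ` snd S)"

text \<open>The vertex set of a simplicial complex is nonempty, so its rank is at least 1 and the
  natural-number subtraction below does not truncate.\<close>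

definition cplx_dim :: "'a cplx \<Rightarrow> nat" where
  "cplx_dim S = cplx_rank S - 1"

text \<open>Boolean matrices are represented by their entry functions, with \<^const>\<open>True\<close> for 1 and
  \<^const>\<open>False\<close> for 0. In \<open>lower_unitriangular k N\<close> only the entries \<open>N i j\<close> with \<open>i, j < k\<close>
  are relevant.\<close>

definition lower_unitriangular :: "nat \<Rightarrow> (nat \<Rightarrow> nat \<Rightarrow> bool) \<Rightarrow> bool" where
  "lower_unitriangular k N \<longleftrightarrow>
     (\<forall>i<k. N i i) \<and> (\<forall>i<k. \<forall>j<k. i < j \<longrightarrow> \<not> N i j)"

text \<open>The submatrix of \<open>M\<close> with row set \<open>R\<close> and column set \<open>X\<close> is square, and independent orderings
  \<open>r\<close> of its rows and \<open>c\<close> of its columns make it lower unitriangular. The empty submatrix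
  is nonsingular.\<close>

definition nonsingular_submatrix :: "('r \<Rightarrow> 'a \<Rightarrow> bool) \<Rightarrow> 'r set \<Rightarrow> 'a set \<Rightarrow> bool" where
  "nonsingular_submatrix M R X \<longleftrightarrow>
     (\<exists>k r c. bij_betw r {..<k} R \<and> bij_betw c {..<k} X \<and>
        lower_unitriangular k (\<lambda>i j. M (r i) (c j)))"

text \<open>The matrix \<open>M\<close> has rows indexed by \<open>{..<m}\<close> and columns indexed by \<open>V\<close>.\<close>

definition boolean_representable :: "'a cplx \<Rightarrow> bool" where
  "boolean_representable S \<longleftrightarrow> simplicial_complex S \<and> (case S of (V, H) \<Rightarrow>
     \<exists>(m::nat) M. H = {X. X \<subseteq> V \<and> (\<exists>R\<subseteq>{..<m}. nonsingular_submatrix M R X)})"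

definition truncation :: "nat \<Rightarrow> 'a cplx \<Rightarrow> 'a cplx" where
  "truncation k S = (fst S, snd S \<inter> {X. X \<subseteq> fst S \<and> card X \<le> k})"

definition TBRSC :: "'a cplx \<Rightarrow> bool" where
  "TBRSC S \<longleftrightarrow> (\<exists>S' k. boolean_representable S' \<and> k \<ge> 1 \<and> S = truncation k S')"

definition paving :: "'a cplx \<Rightarrow> bool" where
  "paving S \<longleftrightarrow> {X. X \<subseteq> fst S \<and> card X = cplx_dim S} \<subseteq> snd S"

definition TBPav :: "nat \<Rightarrow> 'a cplx set" where
  "TBPav d = {S. TBRSC S \<and> paving S \<and> cplx_dim S = d}"

end

(* Call a set F of vertices good for a complex H of dimension d if adjoining any vertex outside F
   to any d-element subset of F gives a face of H.  A paving complex H of dimension d is a TBRSC iff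
   every facet X with d + 1 vertices has a vertex x such that X - {x} lies in a good set avoiding x:
   the good sets are the zero sets of the rows of a representing matrix.  Enlarging H keeps good
   sets good, so this criterion passes to unions. *)

theory Submission imports Defs begin

section \<open>Transversals over a family of sets\<close>

text \<open>The sets \<open>F\<close> of successive steps need not be nested: intersecting each with
  all later ones yields a chain of which \<open>X\<close> is a transversal. So \<open>\<F>\<close>
  may be any family, such as the zero sets of arbitrary rows.\<close>

inductive chain_transversal :: "'a set set \<Rightarrow> 'a set \<Rightarrow> bool" for \<F> where
  empty: "chain_transversal \<F> {}"
| insert: "chain_transversal \<F> X \<Longrightarrow> F \<in> \<F> \<Longrightarrow> X \<subseteq> F \<Longrightarrow> x \<notin> F \<Longrightarrow>
    chain_transversal \<F> (insert x X)"

text \<open>Dropping an element skips its step; every later \<open>F\<close> still contains what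
  remains.\<close>

lemma chain_transversal_subset:
  "chain_transversal \<F> X \<Longrightarrow> Y \<subseteq> X \<Longrightarrow> chain_transversal \<F> Y"
proof (induction arbitrary: Y rule: chain_transversal.induct)
  case empty
  then show ?case by (simp add: chain_transversal.empty)
next
  case (insert X F x)
  show ?case
  proof (cases "x \<in> Y")
    case True
    have "chain_transversal \<F> (insert x (Y - {x}))"
      using insert.hyps insert.prems
      by (intro chain_transversal.insert[where F = F] insert.IH) auto
    with True show ?thesis by (simp add: insert_absorb)
  next
    case False
    with insert show ?thesis by blast
  qed
qed

lemma chain_transversal_split:
  assumes "chain_transversal \<F> X" "X \<noteq> {}"
  obtains x F where "x \<in> X" "F \<in> \<F>" "X - {x} \<subseteq> F" "x \<notin> F"
  using assms by (cases rule: chain_transversal.cases) auto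

text \<open>The elements can be added in any order, with the set built so far serving as
  \<open>F\<close>: before each step it has fewer than \<open>d\<close> elements.\<close>

lemma chain_transversal_small:
  assumes "finite X" "card X \<le> d" "X \<subseteq> V"
    and "\<And>F. F \<subseteq> V \<Longrightarrow> card F < d \<Longrightarrow> F \<in> \<F>"
  shows "chain_transversal \<F> X"
  using assms(1-3)
proof (induction X)
  case empty
  show ?case by (rule chain_transversal.empty)
next
  case (insert x X)
  then show ?case
    by (intro chain_transversal.insert[where F = X] assms(4)) auto
qed

section \<open>Boolean matrices and the zero sets of their rows\<close>

definition zero_sets :: "nat \<Rightarrow> (nat \<Rightarrow> 'a \<Rightarrow> bool) \<Rightarrow> 'a set set" where
  "zero_sets m M = (\<lambda>i. {v. \<not> M i v}) ` {..<m}"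

lemma zero_sets_surj:
  assumes "finite \<F>"
  obtains m M where "zero_sets m M = \<F>"
proof -
  obtain m :: nat and f where "\<F> = f ` {i. i < m}"
    using finite_imp_nat_seg_image_inj_on[OF assms] by blast
  then have "zero_sets m (\<lambda>i v. v \<notin> f i) = \<F>"
    by (simp add: zero_sets_def lessThan_def)
  then show thesis by (rule that)
qed

text \<open>New indices go to the front, since the vertex inserted last labels the first column of
  the lower triangular matrix.\<close>

lemma bij_betw_case_nat:
  assumes "bij_betw f {..<k} A" "a \<notin> A"
  shows "bij_betw (case_nat a f) {..<Suc k} (insert a A)"
  using assms by (auto simp: bij_betw_def inj_on_def lessThan_Suc_eq_insert_0 image_image)

lemma bij_betw_Suc:
  assumes "bij_betw f {..<Suc k} A"
  shows "bij_betw (f \<circ> Suc) {..<k} (A - {f 0})"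
  using assms by (auto simp: bij_betw_def inj_on_def lessThan_Suc_eq_insert_0 image_image)

text \<open>The first row has its only 1 in the first column, so its zero set separates
  \<open>c 0\<close> from the rest of \<open>X\<close>. Deleting this row and column leaves a lower
  unitriangular matrix for the induction.\<close>

lemma nonsingular_imp_chain_transversal:
  assumes "bij_betw r {..<k} R" "bij_betw c {..<k} X"
    and "lower_unitriangular k (\<lambda>i j. M (r i) (c j))" "R \<subseteq> {..<m}"
  shows "chain_transversal (zero_sets m M) X"
  using assms
proof (induction k arbitrary: r c R X)
  case 0
  then show ?case by (simp add: bij_betw_def chain_transversal.empty)
next
  case (Suc k)
  have tri: "\<And>i. i < Suc k \<Longrightarrow> M (r i) (c i)"
    "\<And>i j. i < j \<Longrightarrow> j < Suc k \<Longrightarrow> \<not> M (r i) (c j)"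
    using Suc.prems(3) by (auto simp: lower_unitriangular_def)
  have ran: "r 0 \<in> R" "X = c ` {..<Suc k}"
    using Suc.prems(1,2) by (auto simp: bij_betw_def)
  have "chain_transversal (zero_sets m M) (X - {c 0})"
  proof (rule Suc.IH)
    show "bij_betw (r \<circ> Suc) {..<k} (R - {r 0})" "bij_betw (c \<circ> Suc) {..<k} (X - {c 0})"
      by (fact Suc.prems(1,2)[THEN bij_betw_Suc])+
    show "lower_unitriangular k (\<lambda>i j. M ((r \<circ> Suc) i) ((c \<circ> Suc) j))"
      using tri by (simp add: lower_unitriangular_def)
    show "R - {r 0} \<subseteq> {..<m}"
      using Suc.prems(4) by blast
  qed
  moreover have "{v. \<not> M (r 0) v} \<in> zero_sets m M"
    using ran(1) Suc.prems(4) by (auto simp: zero_sets_def)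
  moreover have "X - {c 0} \<subseteq> {v. \<not> M (r 0) v}"
    using tri(2) ran(2) by (auto simp: lessThan_Suc_eq_insert_0)
  ultimately have "chain_transversal (zero_sets m M) (insert (c 0) (X - {c 0}))"
    using tri(1) by (intro chain_transversal.insert) auto
  then show ?case
    using ran(2) by (simp add: insert_absorb)
qed

lemma chain_transversal_imp_nonsingular:
  assumes "chain_transversal (zero_sets m M) X"
  shows "\<exists>R\<subseteq>{..<m}. nonsingular_submatrix M R X"
  using assms
proof (induction rule: chain_transversal.induct)
  case empty
  have "nonsingular_submatrix M {} {}"
    unfolding nonsingular_submatrix_def
    by (rule exI[of _ 0]) (simp add: bij_betw_def lower_unitriangular_def)
  then show ?case by blast
next
  case (insert X F x)
  then obtain R k r c where R: "R \<subseteq> {..<m}" and r: "bij_betw r {..<k} R"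
    and c: "bij_betw c {..<k} X" and tri: "lower_unitriangular k (\<lambda>i j. M (r i) (c j))"
    unfolding nonsingular_submatrix_def by blast
  obtain a where a: "a < m" "F = {v. \<not> M a v}"
    using insert.hyps(2) by (auto simp: zero_sets_def)
  have cX: "\<And>j. j < k \<Longrightarrow> c j \<in> X"
    using c by (auto simp: bij_betw_def)
  have zero: "\<And>j. j < k \<Longrightarrow> \<not> M a (c j)"
    using cX insert.hyps(3) a(2) by blast
  have one: "M a x"
    using insert.hyps(4) a(2) by simp
  \<comment> \<open>Row \<open>a\<close> vanishes on all of \<open>X\<close>, while row
    \<open>r i\<close> has a 1 in column \<open>c i\<close>.\<close>
  have "a \<noteq> r i" if "i < k" for i
    using tri zero that unfolding lower_unitriangular_def by blast
  then have "a \<notin> R"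
    using r by (auto simp: bij_betw_def)
  moreover have "x \<notin> X"
    using insert.hyps(3,4) by blast
  \<comment> \<open>The new first row is a 1 followed by zeros; the entries below that 1 are
    unconstrained.\<close>
  moreover have "lower_unitriangular (Suc k) (\<lambda>i j. M (case_nat a r i) (case_nat x c j))"
    using tri zero one by (simp add: lower_unitriangular_def All_less_Suc2)
  ultimately have "nonsingular_submatrix M (insert a R) (insert x X)"
    unfolding nonsingular_submatrix_def
    by (intro exI[of _ "Suc k"] exI[of _ "case_nat a r"] exI[of _ "case_nat x c"] conjI
        bij_betw_case_nat r c)
  with R a(1) show ?case by (intro exI[of _ "insert a R"]) auto
qed

lemma nonsingular_iff_chain_transversal:
  "(\<exists>R\<subseteq>{..<m}. nonsingular_submatrix M R X) \<longleftrightarrow> chain_transversal (zero_sets m M) X"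
proof
  assume "\<exists>R\<subseteq>{..<m}. nonsingular_submatrix M R X"
  then show "chain_transversal (zero_sets m M) X"
    unfolding nonsingular_submatrix_def by (blast intro: nonsingular_imp_chain_transversal)
qed (rule chain_transversal_imp_nonsingular)

lemma boolean_representable_iff:
  "boolean_representable (V, H) \<longleftrightarrow> simplicial_complex (V, H) \<and>
     (\<exists>\<F>. finite \<F> \<and> H = {X. X \<subseteq> V \<and> chain_transversal \<F> X})"
proof -
  have "finite (zero_sets m M)" for m :: nat and M :: "nat \<Rightarrow> 'a \<Rightarrow> bool"
    by (simp add: zero_sets_def)
  then have "(\<exists>m M. H = {X. X \<subseteq> V \<and> chain_transversal (zero_sets m M) X}) \<longleftrightarrow>
      (\<exists>\<F>. finite \<F> \<and> H = {X. X \<subseteq> V \<and> chain_transversal \<F> X})"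
    using zero_sets_surj by (intro iffI; elim exE conjE) blast+
  then show ?thesis
    by (simp add: boolean_representable_def nonsingular_iff_chain_transversal)
qed

section \<open>Good sets and the criterion for paving TBRSCs\<close>

text \<open>This is the flat condition tested on sets of size \<open>d\<close> only: in a paving
  complex smaller sets extend automatically, and extending a face of size d + 1 would exceed the
  dimension.\<close>

definition good_set :: "nat \<Rightarrow> 'a set \<Rightarrow> 'a set set \<Rightarrow> 'a set \<Rightarrow> bool" where
  "good_set d V H F \<longleftrightarrow> F \<subseteq> V \<and> (\<forall>I\<subseteq>F. card I = d \<longrightarrow> (\<forall>p\<in>V - F. insert p I \<in> H))"

lemma good_set_mono: "good_set d V H F \<Longrightarrow> H \<subseteq> H' \<Longrightarrow> good_set d V H' F"
  unfolding good_set_def by blast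

text \<open>Closure under subsets is implied: a proper subset of a face has at most \<open>d\<close>
  elements.\<close>

definition good_paving :: "nat \<Rightarrow> 'a set \<Rightarrow> 'a set set \<Rightarrow> bool" where
  "good_paving d V H \<longleftrightarrow> finite V \<and> H \<subseteq> Pow V \<and>
     (\<forall>X\<subseteq>V. card X \<le> d \<longrightarrow> X \<in> H) \<and> (\<forall>X\<in>H. card X \<le> Suc d) \<and> (\<exists>X\<in>H. card X = Suc d) \<and>
     (\<forall>X\<in>H. card X = Suc d \<longrightarrow> (\<exists>x\<in>X. \<exists>F. good_set d V H F \<and> X - {x} \<subseteq> F \<and> x \<notin> F))"

lemma good_paving_Un:
  assumes "good_paving d V H" "good_paving d V H'"
  shows "good_paving d V (H \<union> H')"
proof -
  have "\<exists>x\<in>X. \<exists>F. good_set d V (H \<union> H') F \<and> X - {x} \<subseteq> F \<and> x \<notin> F"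
    if X: "X \<in> H \<union> H'" "card X = Suc d" for X
  proof -
    obtain x F where "x \<in> X" "good_set d V H F \<or> good_set d V H' F" "X - {x} \<subseteq> F" "x \<notin> F"
      using X assms unfolding good_paving_def by (metis Un_iff)
    then show ?thesis
      using good_set_mono[of d V _ F "H \<union> H'"] by blast
  qed
  moreover have "finite V" "H \<union> H' \<subseteq> Pow V"
    "\<And>X. X \<subseteq> V \<Longrightarrow> card X \<le> d \<Longrightarrow> X \<in> H \<union> H'"
    "\<And>X. X \<in> H \<union> H' \<Longrightarrow> card X \<le> Suc d" "\<exists>X\<in>H \<union> H'. card X = Suc d"
    using assms by (auto simp: good_paving_def)
  ultimately show ?thesis
    unfolding good_paving_def by simp
qed

text \<open>A zero set cut down to \<open>V\<close> is good: its subsets of size \<open>d\<close>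
  are transversals by paving, and the zero set itself allows one more step.\<close>

lemma TBPav_imp_good_paving:
  assumes "d \<ge> 1" "(V, H) \<in> TBPav d"
  shows "good_paving d V H"
proof -
  obtain V0 H0 k where "boolean_representable (V0, H0)" and "(V, H) = truncation k (V0, H0)"
    using assms(2) unfolding TBPav_def TBRSC_def by auto
  then have rep: "boolean_representable (V, H0)" and H: "H = {X \<in> H0. X \<subseteq> V \<and> card X \<le> k}"
    by (auto simp: truncation_def)
  then obtain \<F> where sc: "simplicial_complex (V, H0)"
    and H0: "H0 = {X. X \<subseteq> V \<and> chain_transversal \<F> X}"
    unfolding boolean_representable_iff by blast
  have V: "finite V"
    using sc by (simp add: simplicial_complex_def)
  have HV: "H \<subseteq> Pow V" using H by blast
  have fin: "finite H" using V HV by (meson finite_Pow_iff finite_subset)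
  \<comment> \<open>As d is at least 1, the subtraction in \<open>cplx_dim\<close> can be
    inverted.\<close>
  have rank: "Max (card ` H) = Suc d"
    using assms by (auto simp: TBPav_def cplx_dim_def cplx_rank_def)
  have "{} \<in> H" using H H0 by (auto intro: chain_transversal.empty)
  then have "Suc d \<in> card ` H" using rank fin Max_in[of "card ` H"] by auto
  then obtain Y where Y: "Y \<in> H" "card Y = Suc d" by auto
  have le: "card X \<le> Suc d" if "X \<in> H" for X
    using Max_ge[of "card ` H" "card X"] fin rank that by simp
  \<comment> \<open>A face of size d + 1 survived the truncation.\<close>
  have k: "Suc d \<le> k" using Y H by auto
  have V_card: "d \<le> card V"
    using Y HV card_mono[OF V, of Y] by auto
  have pave: "X \<in> H" if "X \<subseteq> V" "card X = d" for X
    using assms(2) that unfolding TBPav_def paving_def by auto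
  have small: "X \<in> H" if X: "X \<subseteq> V" "card X \<le> d" for X
  proof -
    \<comment> \<open>Paving speaks of size exactly \<open>d\<close>, so \<open>X\<close> is
      enlarged to that size first.\<close>
    obtain Z where "X \<subseteq> Z" "Z \<subseteq> V" "card Z = d"
      using exists_subset_between[OF X(2) V_card X(1) V] by blast
    then have "chain_transversal \<F> X"
      using pave[of Z] H H0 chain_transversal_subset by blast
    then show ?thesis using H H0 X k by auto
  qed
  have "\<exists>x\<in>X. \<exists>F. good_set d V H F \<and> X - {x} \<subseteq> F \<and> x \<notin> F"
    if X: "X \<in> H" "card X = Suc d" for X
  proof -
    have "chain_transversal \<F> X" "X \<noteq> {}" using X H H0 by auto
    then obtain x F where x: "x \<in> X" "F \<in> \<F>" "X - {x} \<subseteq> F" "x \<notin> F"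
      by (rule chain_transversal_split)
    have "insert p I \<in> H" if I: "I \<subseteq> F \<inter> V" "card I = d" "p \<in> V - F" for I p
    proof -
      have "chain_transversal \<F> I" using pave[of I] I H H0 by auto
      then have "chain_transversal \<F> (insert p I)"
        using x(2) I by (intro chain_transversal.insert) auto
      moreover have "card (insert p I) \<le> k"
        using card_insert_le_m1[of k I p] I k by auto
      ultimately show ?thesis using H H0 I by auto
    qed
    then have "good_set d V H (F \<inter> V)"
      unfolding good_set_def by auto
    moreover have "X - {x} \<subseteq> F \<inter> V" using x(3) X HV by blast
    ultimately show ?thesis using x by blast
  qed
  then show ?thesis
    unfolding good_paving_def using V HV small le Y by blast
qed

text \<open>All good sets together represent a complex \<open>H0\<close>, possibly of larger
  dimension, whose truncation at d + 1 is \<open>H\<close>.\<close>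

lemma good_paving_imp_TBPav:
  assumes "d \<ge> 1" "good_paving d V H"
  shows "(V, H) \<in> TBPav d"
proof -
  have V: "finite V" and HV: "H \<subseteq> Pow V"
    and small: "\<And>X. X \<subseteq> V \<Longrightarrow> card X \<le> d \<Longrightarrow> X \<in> H"
    and le: "\<And>X. X \<in> H \<Longrightarrow> card X \<le> Suc d"
    and good: "\<And>X. X \<in> H \<Longrightarrow> card X = Suc d \<Longrightarrow>
      \<exists>x\<in>X. \<exists>F. good_set d V H F \<and> X - {x} \<subseteq> F \<and> x \<notin> F"
    using assms(2) unfolding good_paving_def by auto
  obtain Y where Y: "Y \<in> H" "card Y = Suc d"
    using assms(2) unfolding good_paving_def by auto
  define \<F> where "\<F> = {F. good_set d V H F}"
  define H0 where "H0 = {X. X \<subseteq> V \<and> chain_transversal \<F> X}"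
  have fin\<F>: "finite \<F>"
    using V by (intro finite_subset[of \<F> "Pow V"]) (auto simp: \<F>_def good_set_def)
  \<comment> \<open>Such a set is vacuously good, having no subset of size \<open>d\<close>.\<close>
  have tiny: "F \<in> \<F>" if "F \<subseteq> V" "card F < d" for F
  proof -
    have "card I < d" if "I \<subseteq> F" for I
      using card_mono[of F I] that \<open>F \<subseteq> V\<close> \<open>card F < d\<close> V finite_subset by fastforce
    with that show ?thesis by (auto simp: \<F>_def good_set_def)
  qed
  have small0: "chain_transversal \<F> X" if "X \<subseteq> V" "card X \<le> d" for X
    using chain_transversal_small[of X d V \<F>] that tiny V finite_subset by blast
  have "V \<noteq> {}" using Y HV by auto
  then have sc: "simplicial_complex (V, H0)"
    using V assms(1) small0 chain_transversal_subset
    by (auto simp: simplicial_complex_def H0_def)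
  have trunc: "X \<in> H \<longleftrightarrow> X \<in> H0 \<and> card X \<le> Suc d" for X
  proof (cases "card X = Suc d")
    case True
    show ?thesis
    proof
      assume X: "X \<in> H"
      then obtain x F where x: "x \<in> X" "good_set d V H F" "X - {x} \<subseteq> F" "x \<notin> F"
        using good True by blast
      have "chain_transversal \<F> (X - {x})"
        using X HV True x(1) by (intro small0) (auto simp: card_Diff_singleton)
      then have "chain_transversal \<F> (insert x (X - {x}))"
        using x by (intro chain_transversal.insert) (auto simp: \<F>_def)
      then show "X \<in> H0 \<and> card X \<le> Suc d"
        using x(1) X HV True by (auto simp: H0_def insert_absorb)
    next
      assume X: "X \<in> H0 \<and> card X \<le> Suc d"
      then have "chain_transversal \<F> X" "X \<noteq> {}" using True by (auto simp: H0_def)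
      then obtain x F where x: "x \<in> X" "F \<in> \<F>" "X - {x} \<subseteq> F" "x \<notin> F"
        by (rule chain_transversal_split)
      \<comment> \<open>Goodness of \<open>F\<close> is applied to \<open>X - {x}\<close>, which has
        \<open>d\<close> elements, and the outside vertex \<open>x\<close>.\<close>
      then have "insert x (X - {x}) \<in> H"
        using X True by (auto simp: \<F>_def good_set_def H0_def card_Diff_singleton
            simp del: insert_Diff_single)
      then show "X \<in> H" using x(1) by (simp add: insert_absorb)
    qed
  next
    case False
    \<comment> \<open>Subsets of \<open>V\<close> with at most \<open>d\<close> elements satisfy
      both sides, larger ones neither.\<close>
    then have "card X \<le> Suc d \<longleftrightarrow> card X \<le> d" by auto
    with small[of X] small0[of X] le[of X] HV show ?thesis
      unfolding H0_def by blast
  qed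
  have "boolean_representable (V, H0)"
    using sc fin\<F> by (auto simp: boolean_representable_iff H0_def)
  moreover have "(V, H) = truncation (Suc d) (V, H0)"
    using trunc HV by (auto simp: truncation_def)
  ultimately have "TBRSC (V, H)"
    unfolding TBRSC_def by (metis One_nat_def Suc_le_mono le0)
  moreover have "finite H" using V HV by (meson finite_Pow_iff finite_subset)
  then have "Max (card ` H) = Suc d"
    using Y le by (intro Max_eqI) force+
  then have dim: "cplx_dim (V, H) = d"
    by (simp add: cplx_dim_def cplx_rank_def)
  moreover have "paving (V, H)"
    unfolding paving_def dim using small by simp blast
  ultimately show ?thesis by (simp add: TBPav_def)
qed

theorem theorem5p3:
  fixes V :: "'a set" and H H' :: "'a set set" and d :: nat
  assumes "d \<ge> 1"
    and "finite V" and "V \<noteq> {}"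
    and "(V, H) \<in> TBPav d"
    and "(V, H') \<in> TBPav d"
  shows "(V, H \<union> H') \<in> TBPav d"
  by (rule good_paving_imp_TBPav[OF assms(1) good_paving_Un[OF
        assms(4,5)[THEN TBPav_imp_good_paving[OF assms(1)]]]])

end
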